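(* Let $V$ be a metrizable separable topological vector space over $\mathbb{K}$ and let $W$ be a vector subspace of $V$. If $W$ has infinite codimension in $V$, then $V\setminus W$ is $(k,\aleph_{0})$-dense lineable in $V$, for each $k\in\mathbb{N}$.
   Context: $\mathbb{K}$ denotes $\mathbb{R}$ or $\mathbb{C}$; $\mathbb{N}$ is the set of positive integers; dimension and codimension are algebraic (Hamel). A subset $A$ of a vector space $V$ is $\alpha$-lineable if $A\cup\{0\}$ contains an $\alpha$-dimensional vector subspace of $V$. If $V$ is a vector space endowed with a topology, a non-empty subset $A\subset V$ is $(\alpha,\beta)$-dense lineable if it is $\alpha$-lineable and for each $\alpha$-dimensional subspace $W_{\alpha}\subset A\cup\{0\}$ there is a $\beta$-dimensional dense subspace $W_{\beta}$ of $V$ such that $W_{\alpha}\subset W_{\beta}\subset A\cup\{0\}$. *)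

theory Defs
  imports "HOL-Analysis.Analysis"
begin

unbundle cardinal_syntax

text \<open>Cardinals are cardinal orders in the sense of the HOL cardinal library, taken up to
  \<open>=o\<close>: the finite cardinal \<open>n\<close> is \<open>natLeq_on n\<close>, and aleph-null is
  \<open>natLeq\<close>. The scalar multiplication is an explicit parameter, so that the same definitions
  apply over the reals and over the complex numbers.\<close>

locale topological_vector_space = vector_space scale
  for scale :: "'a::{field, topological_space} \<Rightarrow> 'b::topological_ab_group_add \<Rightarrow> 'b" +
  assumes continuous_scale: "continuous_on UNIV (\<lambda>(c, x). scale c x)"
begin

text \<open>Algebraic (Hamel) dimension. As \<open>U\<close> is a span, it is automatically a subspace.\<close>

definition subspace_of_dim :: "'b set \<Rightarrow> 'c rel \<Rightarrow> bool" where
  "subspace_of_dim U \<alpha> \<longleftrightarrow> (\<exists>B. independent B \<and> span B = U \<and> |B| =o \<alpha>)"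

text \<open>The quotient of the whole space by \<open>W\<close> is not available as a type; the codimension of
  \<open>W\<close> is the dimension of an algebraic complement of \<open>W\<close>, onto which that quotient
  is linearly isomorphic.\<close>

definition has_codim :: "'b set \<Rightarrow> 'c rel \<Rightarrow> bool" where
  "has_codim W \<alpha> \<longleftrightarrow> subspace W \<and>
     (\<exists>U. subspace_of_dim U \<alpha> \<and> W \<inter> U = {0} \<and> {w + u | w u. w \<in> W \<and> u \<in> U} = UNIV)"

text \<open>Cardinals on the type of vectors suffice, since a basis of a complement is a set of vectors.\<close>

definition infinite_codim :: "'b set \<Rightarrow> bool" where
  "infinite_codim W \<longleftrightarrow> (\<exists>\<alpha> :: 'b rel. Cinfinite \<alpha> \<and> has_codim W \<alpha>)"

definition lineable :: "'c rel \<Rightarrow> 'b set \<Rightarrow> bool" where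
  "lineable \<alpha> A \<longleftrightarrow> (\<exists>U. subspace_of_dim U \<alpha> \<and> U \<subseteq> A \<union> {0})"

definition dense_lineable :: "'c rel \<Rightarrow> 'd rel \<Rightarrow> 'b set \<Rightarrow> bool" where
  "dense_lineable \<alpha> \<beta> A \<longleftrightarrow> A \<noteq> {} \<and> lineable \<alpha> A \<and>
     (\<forall>U. subspace_of_dim U \<alpha> \<and> U \<subseteq> A \<union> {0} \<longrightarrow>
       (\<exists>D. subspace_of_dim D \<beta> \<and> closure D = UNIV \<and> U \<subseteq> D \<and> D \<subseteq> A \<union> {0}))"

end

end

theory Submission
  imports Defs
begin

text \<open>Why the theorem holds: let \<open>U\<close> be a finite-dimensional subspace that meets \<open>W\<close> only in
  \<open>0\<close>. A separable metrizable space has a countable base, so it suffices to pick vectors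
  \<open>v\<^sub>0, v\<^sub>1, \<dots>\<close>, one in each non-empty basic open set, in such a way that
  \<open>D = span (U \<union> {v\<^sub>0, v\<^sub>1, \<dots>})\<close> still meets \<open>W\<close> only in \<open>0\<close>; then \<open>D\<close> is dense
  of countable dimension.

  Each \<open>v\<^sub>n\<close> is taken outside \<open>S\<^sub>n = span (W \<union> U \<union> {v\<^sub>0, \<dots>, v\<^sub>n\<^sub>-\<^sub>1})\<close>. This can be done inside any
  given non-empty open set: \<open>S\<^sub>n\<close> is proper because \<open>W\<close> has infinite codimension
  (\<open>span_Un_finite_neq_UNIV\<close>), and a proper subspace has empty interior because the scalar field
  is not discrete (\<open>open_not_subset_proper_subspace\<close>). Choosing outside \<open>S\<^sub>n\<close> keeps the family
  independent and its span transversal to \<open>W\<close> (\<open>transversal_sequence\<close>): if an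
  element of \<open>D\<close> lies in \<open>W\<close>, the last \<open>v\<^sub>n\<close> with a non-zero coefficient in it would belong to
  \<open>S\<^sub>n\<close>, so no \<open>v\<^sub>n\<close> occurs and the element is in \<open>U \<inter> W = {0}\<close>.\<close>

section \<open>Countable bases and finite cardinals\<close>

text \<open>The balls of radius \<open>1/(n+1)\<close> about the points of a countable dense set form a base: a point
  of the dense set within \<open>1/(n+1) < r/2\<close> of \<open>x\<close> is the centre of such a ball around \<open>x\<close>
  that stays inside the \<open>r\<close>-ball about \<open>x\<close>.\<close>

lemma metrizable_separable_imp_second_countable:
  assumes "metrizable_space X" "separable_space X"
  shows "second_countable X"
proof -
  from assms(1) obtain M d where Md: "Metric_space M d" and X: "X = Metric_space.mtopology M d"
    unfolding metrizable_space_def by blast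
  interpret Metric_space M d by (rule Md)
  obtain C where C: "countable C" "C \<subseteq> M" "mtopology closure_of C = M"
    using assms(2) unfolding separable_space_def X by auto
  define \<B> where "\<B> = (\<lambda>(c, n). mball c (inverse (real (Suc n)))) ` (C \<times> UNIV)"
  have "\<exists>V\<in>\<B>. x \<in> V \<and> V \<subseteq> T" if T: "openin mtopology T" "x \<in> T" for T x
  proof -
    obtain r where r: "r > 0" "mball x r \<subseteq> T" and xM: "x \<in> M"
      using T unfolding openin_mtopology by blast
    obtain n where n: "inverse (real (Suc n)) < r / 2"
      using r(1) reals_Archimedean[of "r / 2"] by auto
    let ?e = "inverse (real (Suc n))"
    have "x \<in> mtopology closure_of C" using C xM by simp
    moreover have "?e > 0" by simp
    ultimately obtain c where c: "c \<in> C" "c \<in> mball x ?e"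
      unfolding metric_closure_of by blast
    have "mball c ?e \<subseteq> mball x r"
    proof
      fix y assume y: "y \<in> mball c ?e"
      then have "d x y \<le> d x c + d c y" using c by (intro triangle) auto
      also have "\<dots> < r" using y c n by (auto simp del: of_nat_Suc)
      finally show "y \<in> mball x r" using y xM by auto
    qed
    moreover have "x \<in> mball c ?e" using c xM by (auto simp: commute)
    ultimately show ?thesis
      using c(1) r(2) unfolding \<B>_def by (intro bexI[of _ "mball c ?e"]) auto
  qed
  moreover have "countable \<B>" "\<forall>V\<in>\<B>. openin mtopology V"
    unfolding \<B>_def using C(1) by auto
  ultimately show ?thesis
    unfolding second_countable_def X by blast
qed

lemma card_of_ordIso_natLeq_on_iff: "|A| =o natLeq_on k \<longleftrightarrow> |A| =o |{..<k}|"
proof -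
  have "|{..<k}| =o natLeq_on k"
    using finite_well_order_on_ordIso[OF _ card_of_well_order_on natLeq_on_well_order_on, of k]
    by (simp add: lessThan_def)
  then show ?thesis
    using ordIso_transitive ordIso_symmetric by blast
qed

section \<open>Linear algebra relative to a subspace\<close>

context vector_space
begin

text \<open>Modulo \<open>W\<close>, every element of \<open>F\<close> may be replaced by its component in the complement
  \<open>span B\<close>. If \<open>W\<close> and \<open>F\<close> spanned everything, these finitely many components would span the
  infinite independent set \<open>B\<close>.\<close>

lemma span_Un_finite_neq_UNIV:
  assumes W: "subspace W" and B: "independent B" "infinite B"
    and compl: "W \<inter> span B = {0}" "{w + u | w u. w \<in> W \<and> u \<in> span B} = UNIV"
    and F: "finite F"
  shows "span (W \<union> F) \<noteq> UNIV"
proof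
  assume full: "span (W \<union> F) = UNIV"
  have "\<exists>u. u \<in> span B \<and> f - u \<in> W" for f
  proof -
    have "f \<in> {w + u | w u. w \<in> W \<and> u \<in> span B}" using compl(2) by simp
    then show ?thesis by (force simp: algebra_simps)
  qed
  then obtain p where p: "\<And>f. p f \<in> span B" "\<And>f. f - p f \<in> W" by metis
  have sub: "span (p ` F) \<subseteq> span B"
    using p(1) by (intro span_minimal) auto
  have "f \<in> span (W \<union> p ` F)" if "f \<in> F" for f
  proof -
    have "f - p f \<in> span (W \<union> p ` F)" using p(2) by (intro span_base) auto
    moreover have "p f \<in> span (W \<union> p ` F)" using that by (intro span_base) auto
    ultimately show ?thesis using span_add by fastforce
  qed
  then have "span (W \<union> F) \<subseteq> span (W \<union> p ` F)"
    by (intro span_minimal) (auto intro: span_base)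
  then have full': "span (W \<union> p ` F) = UNIV" using full by auto
  have "B \<subseteq> span (p ` F)"
  proof
    fix b assume b: "b \<in> B"
    have "b \<in> span (W \<union> p ` F)" using full' by simp
    then obtain w g where wg: "w \<in> span W" "g \<in> span (p ` F)" "b = w + g"
      unfolding span_Un by auto
    have "w = b - g" using wg by simp
    moreover have "b - g \<in> span B" using span_base[OF b] wg(2) sub span_diff by blast
    moreover have "w \<in> W" using wg(1) W span_eq_iff by blast
    ultimately have "w = 0" using compl(1) by blast
    then show "b \<in> span (p ` F)" using wg by simp
  qed
  then show False
    using independent_span_bound[OF finite_imageI[OF F] B(1)] B(2) by blast
qed

text \<open>If \<open>x = k a + y\<close> lies in \<open>W\<close> with \<open>y \<in> span A\<close> and \<open>k \<noteq> 0\<close>, then \<open>a\<close> can be solved for and lies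
  in \<open>span (W \<union> A)\<close>.\<close>

lemma span_insert_Int_subspace:
  assumes W: "subspace W" and A: "span A \<inter> W = {0}" and a: "a \<notin> span (W \<union> A)"
  shows "span (insert a A) \<inter> W = {0}"
proof -
  have "x = 0" if x: "x \<in> span (insert a A)" "x \<in> W" for x
  proof -
    obtain k where k: "x - scale k a \<in> span A"
      using x(1) unfolding span_breakdown_eq by blast
    have "x \<in> span (W \<union> A)" using x(2) by (intro span_base) auto
    moreover have "x - scale k a \<in> span (W \<union> A)" using k span_mono[of A "W \<union> A"] by auto
    ultimately have "x - (x - scale k a) \<in> span (W \<union> A)" by (rule span_diff)
    then have "scale k a \<in> span (W \<union> A)" by simp
    then have "k = 0" using a span_scale[of "scale k a" "W \<union> A" "inverse k"]
      by (cases "k = 0") simp_all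
    then show ?thesis using k x A by auto
  qed
  then show ?thesis using W span_zero subspace_0 by auto
qed

text \<open>Independence and transversality hold for each finite stage by induction, one new vector at a
  time; they pass to the union because an element of a span uses only finitely many
  generators.\<close>

lemma transversal_sequence:
  fixes v :: "nat \<Rightarrow> 'b"
  assumes W: "subspace W" and B: "independent B" "span B \<inter> W = {0}"
    and v: "\<And>n. v n \<notin> span (W \<union> B \<union> v ` {..<n})"
  shows "independent (B \<union> range v)" "span (B \<union> range v) \<inter> W = {0}" "inj v"
proof -
  define A where "A n = B \<union> v ` {..<n}" for n :: nat
  have A_Suc: "A (Suc n) = insert (v n) (A n)" for n
    by (auto simp: A_def lessThan_Suc)
  have v': "v n \<notin> span (W \<union> A n)" for n
    using v[of n] by (simp add: A_def Un_assoc)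
  have fin: "independent (A n) \<and> span (A n) \<inter> W = {0}" for n
  proof (induction n)
    case 0
    then show ?case using B by (simp add: A_def)
  next
    case (Suc n)
    have "v n \<notin> span (A n)" using v'[of n] span_mono[of "A n" "W \<union> A n"] by auto
    then show ?case
      unfolding A_Suc using Suc span_insert_Int_subspace[OF W _ v'] independent_insertI by blast
  qed
  have mono: "A m \<subseteq> A n" if "m \<le> n" for m n using that by (auto simp: A_def)
  have Un: "B \<union> range v = \<Union>(range A)" by (auto simp: A_def)
  show "independent (B \<union> range v)"
    unfolding Un
  proof (rule independent_Union_directed)
    show "c \<subseteq> d \<or> d \<subseteq> c" if cd: "c \<in> range A" "d \<in> range A" for c d
    proof -
      obtain m n where "c = A m" "d = A n" using cd by auto
      then show ?thesis using mono nat_le_linear[of m n] by blast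
    qed
  qed (use fin in auto)
  have "x = 0" if x: "x \<in> span (B \<union> range v)" "x \<in> W" for x
  proof -
    obtain t where t: "finite t" "t \<subseteq> B \<union> range v" "x \<in> span t"
      using x(1) unfolding span_explicit[of "B \<union> range v"]
      by (blast intro: span_sum span_scale span_base)
    have "finite (t - B)" "t - B \<subseteq> range v" using t by auto
    then obtain J where J: "finite J" "t - B = v ` J" by (meson finite_subset_image)
    then obtain n where "J \<subseteq> {..<n}" by (auto simp: finite_nat_iff_bounded)
    then have "t \<subseteq> A n" using J(2) unfolding A_def by blast
    then have "x \<in> span (A n)" using t(3) span_mono by blast
    then show ?thesis using fin[of n] x(2) by blast
  qed
  then show "span (B \<union> range v) \<inter> W = {0}" using W span_zero subspace_0 by auto
  show "inj v"
  proof (rule linorder_injI)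
    fix m n :: nat assume "m < n"
    then have "v m \<in> span (W \<union> B \<union> v ` {..<n})" by (intro span_base) auto
    then show "v m \<noteq> v n" using v[of n] by auto
  qed
qed

end

section \<open>Dense subspaces transversal to a given subspace\<close>

context topological_vector_space
begin

text \<open>If \<open>x\<close> lies in \<open>S\<close> and \<open>y\<close> does not, then \<open>x + c y\<close> leaves \<open>S\<close> for every \<open>c \<noteq> 0\<close>, but
  tends to \<open>x\<close> as \<open>c\<close> tends to \<open>0\<close>. The hypothesis on \<open>{0}\<close> says that every neighbourhood of \<open>0\<close>
  contains a non-zero scalar; in a discrete field such \<open>c\<close> need not exist.\<close>

lemma open_not_subset_proper_subspace:
  assumes nd: "\<not> open {0 :: 'a}" and S: "subspace S" "S \<noteq> UNIV" and G: "open G" "G \<noteq> {}"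
  obtains x where "x \<in> G" "x \<notin> S"
proof -
  obtain x where x: "x \<in> G" using G(2) by blast
  obtain y where y: "y \<notin> S" using S(2) by blast
  have "continuous_on UNIV (\<lambda>c. scale c y)"
    using continuous_on_compose2[OF continuous_scale
        continuous_on_Pair[OF continuous_on_id continuous_on_const[of _ y]]]
    by simp
  then have "continuous_on UNIV (\<lambda>c. x + scale c y)"
    by (intro continuous_intros)
  then have "open ((\<lambda>c. x + scale c y) -` G)"
    using G(1) by (simp add: continuous_on_open_vimage)
  moreover have "0 \<in> (\<lambda>c. x + scale c y) -` G" using x by simp
  ultimately have "(\<lambda>c. x + scale c y) -` G \<noteq> {0}" "0 \<in> (\<lambda>c. x + scale c y) -` G"
    using nd by auto
  then obtain c where c: "c \<noteq> 0" "x + scale c y \<in> G" by blast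
  show ?thesis
  proof (cases "x \<in> S")
    case True
    have "x + scale c y \<notin> S"
    proof
      assume "x + scale c y \<in> S"
      then have "x + scale c y - x \<in> S" using True S(1) subspace_diff by blast
      then have "scale (inverse c) (scale c y) \<in> S" using S(1) subspace_scale by fastforce
      then show False using c(1) y by simp
    qed
    then show ?thesis using c(2) that by blast
  qed (use x that in blast)
qed

text \<open>The hypothesis that no finite set spans the whole space together with \<open>W\<close> is the form in
  which infinite codimension enters: at each stage only finitely many vectors, those of \<open>B\<close> and
  the ones already chosen, have been added to \<open>W\<close>.\<close>

lemma ex_dense_transversal_extension:
  assumes nd: "\<not> open {0 :: 'a}" and sc: "second_countable (euclidean :: 'b topology)"
    and W: "subspace W" and B: "independent B" "finite B" "span B \<inter> W = {0}"
    and proper: "\<And>F. finite F \<Longrightarrow> span (W \<union> F) \<noteq> UNIV"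
  obtains D where "subspace_of_dim D natLeq" "closure D = UNIV" "span B \<subseteq> D" "D \<inter> W = {0}"
proof -
  obtain \<B> :: "'b set set" where \<B>: "countable \<B>" "\<And>G. G \<in> \<B> \<Longrightarrow> open G"
      "\<And>G x. open G \<Longrightarrow> x \<in> G \<Longrightarrow> \<exists>H\<in>\<B>. x \<in> H \<and> H \<subseteq> G"
    using sc unfolding second_countable_def open_openin[symmetric] by metis
  \<comment> \<open>The whole space is added so that the enumeration ranges over a non-empty set.\<close>
  define \<C> where "\<C> = insert UNIV (\<B> - {{}})"
  define N where "N = from_nat_into \<C>"
  have rangeN: "range N = \<C>"
    unfolding N_def using \<B>(1) by (intro range_from_nat_into) (auto simp: \<C>_def)
  have N: "open (N n)" "N n \<noteq> {}" for n
  proof -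
    have "N n \<in> \<C>" using rangeN by auto
    then show "open (N n)" "N n \<noteq> {}" using \<B>(2) by (auto simp: \<C>_def)
  qed
  have "\<exists>v. \<forall>n. v n \<in> N n \<and> v n \<notin> span (W \<union> B \<union> v ` {..<n})"
  proof (rule dependent_wf_choice[OF wf, where
        P = "\<lambda>v n x. x \<in> N n \<and> x \<notin> span (W \<union> B \<union> v ` {..<n})"])
    fix f g :: "nat \<Rightarrow> 'b" and n x
    assume "\<And>m. (m, n) \<in> {(m, n). m < n} \<Longrightarrow> f m = g m"
    then have "f ` {..<n} = g ` {..<n}" by (intro image_cong) auto
    then show "(x \<in> N n \<and> x \<notin> span (W \<union> B \<union> f ` {..<n})) =
        (x \<in> N n \<and> x \<notin> span (W \<union> B \<union> g ` {..<n}))" by simp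
  next
    fix n :: nat and f :: "nat \<Rightarrow> 'b"
    have "span (W \<union> B \<union> f ` {..<n}) \<noteq> UNIV"
      using proper[of "B \<union> f ` {..<n}"] B(2) by (simp add: Un_assoc)
    then show "\<exists>x. x \<in> N n \<and> x \<notin> span (W \<union> B \<union> f ` {..<n})"
      using open_not_subset_proper_subspace[OF nd subspace_span _ N] by blast
  qed
  then obtain v where v: "\<And>n. v n \<in> N n" "\<And>n. v n \<notin> span (W \<union> B \<union> v ` {..<n})"
    by blast
  note ts = transversal_sequence[OF W B(1) B(3) v(2)]
  have "infinite (B \<union> range v)" using ts(3) range_inj_infinite by auto
  moreover have "countable (B \<union> range v)" using B(2) by (auto intro: countable_finite)
  ultimately have "bij_betw (to_nat_on (B \<union> range v)) (B \<union> range v) UNIV"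
    by (intro to_nat_on_infinite)
  then have "|B \<union> range v| =o |UNIV :: nat set|" using card_of_ordIso by blast
  then have "|B \<union> range v| =o natLeq" using card_of_nat ordIso_transitive by blast
  then have "subspace_of_dim (span (B \<union> range v)) natLeq"
    unfolding subspace_of_dim_def using ts(1) by blast
  moreover have "closure (span (B \<union> range v)) = UNIV"
  proof -
    have "G \<inter> span (B \<union> range v) \<noteq> {}" if G: "open G" "x \<in> G" for G x
    proof -
      obtain H where H: "H \<in> \<B>" "x \<in> H" "H \<subseteq> G" using \<B>(3) G by blast
      then have "H \<in> range N" unfolding rangeN \<C>_def by auto
      then obtain n where "N n \<subseteq> G" using H by auto
      moreover have "v n \<in> span (B \<union> range v)" by (intro span_base) auto
      ultimately show ?thesis using v(1)[of n] by blast
    qed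
    then have "x \<in> closure (span (B \<union> range v))" for x
      unfolding closure_iff_nhds_not_empty by blast
    then show ?thesis by blast
  qed
  moreover have "span B \<subseteq> span (B \<union> range v)" by (intro span_mono) auto
  ultimately show ?thesis using that ts(2) by blast
qed

text \<open>The complement has to contain some \<open>k\<close>-dimensional subspace: any \<open>k\<close> elements of a basis of an
  algebraic complement of \<open>W\<close> span one. Each such subspace is then enlarged by the preceding
  lemma.\<close>

theorem dense_lineable_Compl_subspace:
  assumes nd: "\<not> open {0 :: 'a}" and sc: "second_countable (euclidean :: 'b topology)"
    and codim: "infinite_codim W"
  shows "dense_lineable (natLeq_on k) natLeq (UNIV - W)"
proof -
  obtain \<alpha> :: "'b rel" and U where \<alpha>: "Cinfinite \<alpha>" and W: "subspace W"
      and U: "subspace_of_dim U \<alpha>" "W \<inter> U = {0}" "{w + u | w u. w \<in> W \<and> u \<in> U} = UNIV"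
    using codim unfolding infinite_codim_def has_codim_def by blast
  obtain B where B: "independent B" "span B = U" "|B| =o \<alpha>"
    using U(1) unfolding subspace_of_dim_def by blast
  have "infinite B"
    using Cinfinite_cong[OF ordIso_symmetric[OF B(3)] \<alpha>] by (simp add: cinfinite_def Field_card_of)
  note proper = span_Un_finite_neq_UNIV[OF W B(1) this U(2,3)[folded B(2)]]
  obtain C where C: "C \<subseteq> B" "finite C" "card C = k"
    using \<open>infinite B\<close> infinite_arbitrarily_large by blast
  have lin: "lineable (natLeq_on k) (UNIV - W)"
    unfolding lineable_def subspace_of_dim_def
  proof (intro exI conjI)
    show "independent C" using independent_mono B(1) C(1) by blast
    have "\<exists>f. bij_betw f C {..<k}" using C by (intro finite_same_card_bij) auto
    then show "|C| =o natLeq_on k"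
      unfolding card_of_ordIso_natLeq_on_iff using card_of_ordIso by blast
    show "span C \<subseteq> UNIV - W \<union> {0}" using span_mono[OF C(1)] B(2) U(2) by blast
  qed (rule refl)
  have "W \<noteq> UNIV" using proper[of "{}"] span_eq_iff W by auto
  moreover have "\<exists>D. subspace_of_dim D natLeq \<and> closure D = UNIV \<and> U' \<subseteq> D \<and> D \<subseteq> UNIV - W \<union> {0}"
    if U': "subspace_of_dim U' (natLeq_on k)" "U' \<subseteq> UNIV - W \<union> {0}" for U'
  proof -
    obtain A where A: "independent A" "span A = U'" "|A| =o |{..<k}|"
      using U'(1) unfolding subspace_of_dim_def card_of_ordIso_natLeq_on_iff by blast
    have "finite A" using card_of_ordIso_finite[OF A(3)] by simp
    moreover have "span A \<inter> W = {0}"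
      using U'(2) A(2) span_zero[of A] subspace_0[OF W] by blast
    ultimately obtain D where D: "subspace_of_dim D natLeq" "closure D = UNIV" "span A \<subseteq> D"
        "D \<inter> W = {0}"
      by (rule ex_dense_transversal_extension[OF nd sc W A(1) _ _ proper])
    then have "D \<subseteq> UNIV - W \<union> {0}" by blast
    then show ?thesis using D(1-3) A(2) by auto
  qed
  ultimately show ?thesis unfolding dense_lineable_def using lin by blast
qed

end

theorem theorem4p3:
  fixes scale_r :: "real \<Rightarrow> 'v::topological_ab_group_add \<Rightarrow> 'v"
    and scale_c :: "complex \<Rightarrow> 'w::topological_ab_group_add \<Rightarrow> 'w"
  shows
    "(topological_vector_space scale_r
        \<and> metrizable_space (euclidean :: 'v topology) \<and> separable_space (euclidean :: 'v topology)
      \<longrightarrow> (\<forall>W. module.subspace scale_r W \<and> topological_vector_space.infinite_codim scale_r W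
        \<longrightarrow> (\<forall>k::nat. k \<ge> 1 \<longrightarrow>
              topological_vector_space.dense_lineable scale_r (natLeq_on k) natLeq (UNIV - W))))
     \<and>
     (topological_vector_space scale_c
        \<and> metrizable_space (euclidean :: 'w topology) \<and> separable_space (euclidean :: 'w topology)
      \<longrightarrow> (\<forall>W. module.subspace scale_c W \<and> topological_vector_space.infinite_codim scale_c W
        \<longrightarrow> (\<forall>k::nat. k \<ge> 1 \<longrightarrow>
              topological_vector_space.dense_lineable scale_c (natLeq_on k) natLeq (UNIV - W))))"
proof (intro conjI impI allI; elim conjE)
  fix W and k :: nat
  assume "topological_vector_space scale_r"
    and top: "metrizable_space (euclidean :: 'v topology)" "separable_space (euclidean :: 'v topology)"
    and W: "topological_vector_space.infinite_codim scale_r W"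
  then interpret topological_vector_space scale_r by simp
  show "dense_lineable (natLeq_on k) natLeq (UNIV - W)"
    using metrizable_separable_imp_second_countable[OF top] W
    by (intro dense_lineable_Compl_subspace not_open_singleton)
next
  fix W and k :: nat
  assume "topological_vector_space scale_c"
    and top: "metrizable_space (euclidean :: 'w topology)" "separable_space (euclidean :: 'w topology)"
    and W: "topological_vector_space.infinite_codim scale_c W"
  then interpret topological_vector_space scale_c by simp
  show "dense_lineable (natLeq_on k) natLeq (UNIV - W)"
    using metrizable_separable_imp_second_countable[OF top] W
    by (intro dense_lineable_Compl_subspace not_open_singleton)
qed

end
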